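(* Let $H=H(p,q,t)$ be a toroidal polyhex with two cut cycles $L_x$ and $L_y$. Two nontrivial perfect matchings $M_1$ and $M_2$ of $H$ lie in the same connected component of the resonance graph $R_6(H)$ if and only if ${\rm flow}_{L_j}(H,M_1)={\rm flow}_{L_j}(H,M_2)$ for both $j=x$ and $j=y$.
   Context: Toroidal polyhex: consider the regular hexagonal lattice in the plane with one of its three edge-directions vertical. Use affine coordinates with origin at the centre of a hexagon, horizontal $x$-axis, $y$-axis at angle $60^\circ$ to it, and unit length the distance between two parallel edges of a hexagon, so that hexagon centres are exactly the integer points. For integers $p,q\ge 2$ and $t$, $H(p,q,t)$ is obtained from the $p\times q$-parallelogram $P$ with corners $(0,0),(p,0),(p,q),(0,q)$ by identifying its two lateral sides and then identifying its top side with its bottom side after a twist of $t$ hexagons; equivalently, it is the quotient of the hexagonal lattice by the translation group generated by $(p,0)$ and $(t,q)$. It is a cubic bipartite graph embedded in the torus with all faces hexagons; fix a proper black/white vertex colouring. Winding vector: an oriented closed curve on the torus has winding vector $(m,n)\in\mathbb Z^2$ if a lift to the plane has displacement $m(p,0)+n(t,q)$. Resonance graph: $R_6(H)$ has the perfect matchings of $H$ as vertices, two being adjacent iff their symmetric difference is exactly the set of six edges of a hexagonal face of $H$. Trivial: a perfect matching $M$ of $H$ is trivial if no hexagonal face of $H$ is $M$-alternating (edges alternately in $M$ and not in $M$); otherwise it is nontrivial. Cut cycles and flow: the dual graph has a vertex at the centre of each hexagon, and for each edge $e$ of $H$ a dual edge $e^*$ joining the centres of the two hexagons sharing $e$ and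 crossing only $e$. $L_x$ (resp. $L_y$) is any oriented cycle of the dual graph winding once around in the $x$-axis (resp. $y$-axis) direction, i.e. with winding vector $\pm(1,0)$ (resp. $\pm(0,1)$). For $L\in\{L_x,L_y\}$ let $L^*$ be the set of edges of $H$ crossed by $L$, and let $(L^* )^+$ (resp. $(L^* )^-$) be the set of $e\in L^*$ whose white end-vertex is on the left (resp. right) side of $L$. For a perfect matching $M$, ${\rm flow}_L(H,M)=|(L^* )^+\cap M|-|(L^* )^-\cap M|$. *)

theory Defs
  imports Main "HOL-Library.Product_Plus"
begin

text \<open>
  Affine coordinates with the y-axis at 60 degrees to the x-axis; hexagon centres are the
  integer points.  The six neighbouring centres of \<open>c\<close> are \<open>c + hex_dir k\<close>, in
  counterclockwise order.
\<close>

definition hex_dir :: "nat \<Rightarrow> int \<times> int" where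
  "hex_dir k = [(1, 0), (0, 1), (-1, 1), (-1, 0), (0, -1), (1, -1)] ! (k mod 6)"

text \<open>
  A vertex of the hexagonal lattice is the centroid of the three mutually adjacent centres
  \<open>c\<close>, \<open>c + hex_dir k\<close>, \<open>c + hex_dir (k + 1)\<close>.  Lattice vertices are represented by three
  times their position, that is, by the sum of these three centres, which is integral.  The
  corners of hexagon \<open>c\<close> are \<open>corner c 0, ..., corner c 5\<close>, in counterclockwise order.
\<close>

definition corner :: "int \<times> int \<Rightarrow> nat \<Rightarrow> int \<times> int" where
  "corner c k = c + (c + hex_dir k) + (c + hex_dir (k + 1))"

text \<open>
  The quotient by the group of translations generated by \<open>(p, 0)\<close> and \<open>(t, q)\<close>.  The
  factor 3 in \<open>vertex_class\<close> comes from the scaling of lattice vertices; centres are not scaled.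
\<close>

definition centre_class :: "int \<Rightarrow> int \<Rightarrow> int \<Rightarrow> int \<times> int \<Rightarrow> (int \<times> int) set" where
  "centre_class p q t c = {c + (m * p + n * t, n * q) | m n. True}"

definition vertex_class :: "int \<Rightarrow> int \<Rightarrow> int \<Rightarrow> int \<times> int \<Rightarrow> (int \<times> int) set" where
  "vertex_class p q t v = {v + (3 * (m * p + n * t), 3 * (n * q)) | m n. True}"

text \<open>
  The vertices of \<open>H(p, q, t)\<close> are classes of lattice vertices and its edges are two-element
  sets of such classes (for \<open>p, q \<ge> 2\<close> the quotient has no loops or parallel edges).
  \<open>hex_edge p q t c k\<close> is the edge shared by the hexagons \<open>c\<close> and \<open>c + hex_dir k\<close>; seen
  from \<open>c\<close> towards \<open>c + hex_dir k\<close>, its left end is \<open>corner c k\<close> and its right end is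
  \<open>corner c (k + 5)\<close>, the corner preceding \<open>corner c k\<close>.
\<close>

type_synonym hvertex = "(int \<times> int) set"
type_synonym hedge = "hvertex set"

definition left_end :: "int \<Rightarrow> int \<Rightarrow> int \<Rightarrow> int \<times> int \<Rightarrow> nat \<Rightarrow> hvertex" where
  "left_end p q t c k = vertex_class p q t (corner c k)"

definition right_end :: "int \<Rightarrow> int \<Rightarrow> int \<Rightarrow> int \<times> int \<Rightarrow> nat \<Rightarrow> hvertex" where
  "right_end p q t c k = vertex_class p q t (corner c (k + 5))"

definition hex_edge :: "int \<Rightarrow> int \<Rightarrow> int \<Rightarrow> int \<times> int \<Rightarrow> nat \<Rightarrow> hedge" where
  "hex_edge p q t c k = {left_end p q t c k, right_end p q t c k}"

definition H_verts :: "int \<Rightarrow> int \<Rightarrow> int \<Rightarrow> hvertex set" where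
  "H_verts p q t = {vertex_class p q t (corner c k) | c k. True}"

definition H_edges :: "int \<Rightarrow> int \<Rightarrow> int \<Rightarrow> hedge set" where
  "H_edges p q t = {hex_edge p q t c k | c k. True}"

definition face_edges :: "int \<Rightarrow> int \<Rightarrow> int \<Rightarrow> int \<times> int \<Rightarrow> hedge set" where
  "face_edges p q t c = hex_edge p q t c ` {0..<6}"

text \<open>A colouring is given by the predicate that holds of the white vertices.\<close>

definition proper_colouring :: "int \<Rightarrow> int \<Rightarrow> int \<Rightarrow> (hvertex \<Rightarrow> bool) \<Rightarrow> bool" where
  "proper_colouring p q t white \<longleftrightarrow>
     (\<forall>u v. {u, v} \<in> H_edges p q t \<longrightarrow> white u \<noteq> white v)"

definition perfect_matching :: "int \<Rightarrow> int \<Rightarrow> int \<Rightarrow> hedge set \<Rightarrow> bool" where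
  "perfect_matching p q t M \<longleftrightarrow>
     M \<subseteq> H_edges p q t \<and> (\<forall>v \<in> H_verts p q t. \<exists>!e. e \<in> M \<and> v \<in> e)"

text \<open>\<open>hex_edge\<close> is periodic in \<open>k\<close> with period 6, so \<open>k = 5\<close> compares the last edge with the first.\<close>

definition alternating_face ::
    "int \<Rightarrow> int \<Rightarrow> int \<Rightarrow> hedge set \<Rightarrow> int \<times> int \<Rightarrow> bool" where
  "alternating_face p q t M c \<longleftrightarrow>
     (\<forall>k < 6. hex_edge p q t c k \<in> M \<longleftrightarrow> hex_edge p q t c (k + 1) \<notin> M)"

definition trivial_matching :: "int \<Rightarrow> int \<Rightarrow> int \<Rightarrow> hedge set \<Rightarrow> bool" where
  "trivial_matching p q t M \<longleftrightarrow> (\<nexists>c. alternating_face p q t M c)"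

text \<open>The adjacency relation of the resonance graph, whose vertices are the perfect matchings.\<close>

definition resonance_adj :: "int \<Rightarrow> int \<Rightarrow> int \<Rightarrow> hedge set rel" where
  "resonance_adj p q t =
     {(M, N). perfect_matching p q t M \<and> perfect_matching p q t N \<and>
              (\<exists>c. (M - N) \<union> (N - M) = face_edges p q t c)}"

text \<open>
  The dual graph may have parallel edges (for example when \<open>p = 2\<close>), so an oriented closed walk in
  it is given by a lift to the plane: a starting centre \<open>c\<close> and the list of directions of its
  steps.  \<open>darts c ks\<close> lists the steps as pairs (centre before the step, direction); the step
  \<open>(c, k)\<close> crosses the edge \<open>hex_edge p q t c k\<close> and no other.
\<close>

type_synonym dual_walk = "(int \<times> int) \<times> nat list"

fun darts :: "int \<times> int \<Rightarrow> nat list \<Rightarrow> ((int \<times> int) \<times> nat) list" where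
  "darts c [] = []"
| "darts c (k # ks) = (c, k) # darts (c + hex_dir k) ks"

definition walk_darts :: "dual_walk \<Rightarrow> ((int \<times> int) \<times> nat) list" where
  "walk_darts L = darts (fst L) (snd L)"

definition displacement :: "dual_walk \<Rightarrow> int \<times> int" where
  "displacement L = sum_list (map hex_dir (snd L))"

definition has_winding_vector ::
    "int \<Rightarrow> int \<Rightarrow> int \<Rightarrow> dual_walk \<Rightarrow> int \<times> int \<Rightarrow> bool" where
  "has_winding_vector p q t L w \<longleftrightarrow>
     displacement L = (fst w * p + snd w * t, snd w * q)"

text \<open>A walk is closed in the torus iff it has a winding vector; a cycle repeats no dual vertex
  and no dual edge.\<close>

definition dual_cycle :: "int \<Rightarrow> int \<Rightarrow> int \<Rightarrow> dual_walk \<Rightarrow> bool" where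
  "dual_cycle p q t L \<longleftrightarrow>
     snd L \<noteq> [] \<and> set (snd L) \<subseteq> {0..<6} \<and>
     (\<exists>w. has_winding_vector p q t L w) \<and>
     distinct (map (\<lambda>(c, k). centre_class p q t c) (walk_darts L)) \<and>
     distinct (map (\<lambda>(c, k). hex_edge p q t c k) (walk_darts L))"

definition x_cut_cycle :: "int \<Rightarrow> int \<Rightarrow> int \<Rightarrow> dual_walk \<Rightarrow> bool" where
  "x_cut_cycle p q t L \<longleftrightarrow> dual_cycle p q t L \<and>
     (has_winding_vector p q t L (1, 0) \<or> has_winding_vector p q t L (-1, 0))"

definition y_cut_cycle :: "int \<Rightarrow> int \<Rightarrow> int \<Rightarrow> dual_walk \<Rightarrow> bool" where
  "y_cut_cycle p q t L \<longleftrightarrow> dual_cycle p q t L \<and>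
     (has_winding_vector p q t L (0, 1) \<or> has_winding_vector p q t L (0, -1))"

definition crossed_pos ::
    "int \<Rightarrow> int \<Rightarrow> int \<Rightarrow> (hvertex \<Rightarrow> bool) \<Rightarrow> dual_walk \<Rightarrow> hedge set" where
  "crossed_pos p q t white L =
     {hex_edge p q t c k | c k. (c, k) \<in> set (walk_darts L) \<and> white (left_end p q t c k)}"

definition crossed_neg ::
    "int \<Rightarrow> int \<Rightarrow> int \<Rightarrow> (hvertex \<Rightarrow> bool) \<Rightarrow> dual_walk \<Rightarrow> hedge set" where
  "crossed_neg p q t white L =
     {hex_edge p q t c k | c k. (c, k) \<in> set (walk_darts L) \<and> white (right_end p q t c k)}"

definition flow ::
    "int \<Rightarrow> int \<Rightarrow> int \<Rightarrow> (hvertex \<Rightarrow> bool) \<Rightarrow> dual_walk \<Rightarrow> hedge set \<Rightarrow> int" where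
  "flow p q t white L M =
     int (card (crossed_pos p q t white L \<inter> M)) - int (card (crossed_neg p q t white L \<inter> M))"

end

theory Submission
  imports Defs
begin

text \<open>
  The proof is by height functions.  Orient every dual edge along one of the directions 0, 2, 4.
  These three directions sum to zero, so the three centres around a lattice vertex form a
  cyclically oriented triangle.  Let a step along an oriented dual edge raise the height by 1 if it
  crosses a non-matching edge and lower it by 2 if it crosses a matching edge.  A set of edges is a
  perfect matching iff every vertex has exactly one edge in it, that is, iff the steps around every
  triangle sum to zero.  So perfect matchings correspond to integer functions on the plane of
  centres with steps 1 and -2, up to an additive constant and with steps that are invariant under
  the translation group (\<open>perfect_matching_imp_height\<close>, \<open>height_imp_perfect_matching\<close>).  A face is
  alternating iff its centre is a local extremum of the height, and rotating it changes the height
  by 3 at the translates of that centre and nowhere else (\<open>height_flip\<close>).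

  Along a closed dual walk the increment of the height is, up to a sign and a summand that do not
  depend on the matching, three times the flow across the walk (\<open>flow_eq_iff_height\<close>).  Rotating
  a face keeps the increments over all periods; hence the flows are invariants of the components.

  Conversely, let \<open>M\<close> and \<open>N\<close> have equal flows, with heights \<open>h\<close> and \<open>g\<close>.  Then \<open>g - h\<close> is
  periodic, and after adding a constant to \<open>g\<close> it is nonnegative with all values divisible by 3.
  If some local minimum of \<open>h\<close> lies where \<open>h < g\<close>, it can be raised by 3 and \<open>h \<le> g\<close> still holds;
  the rotated face stays alternating, so this can be repeated until \<open>h = g\<close>
  (\<open>connect_below\<close>).  It remains to find such a local minimum when \<open>h \<noteq> g\<close>
  (\<open>exists_local_minimum\<close>).  If there is none, every centre \<open>c\<close> with \<open>h c < g c\<close> has a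
  predecessor at which \<open>h\<close> is smaller by exactly 1; there \<open>g\<close> is smaller by at most 1, so the
  descent never ends.  As the torus is finite, the descent visits two centres that
  differ by a period \<open>l\<close>: a sum of \<open>n\<close> oriented steps over which \<open>h\<close> rises by \<open>n\<close>.  The rise over
  \<open>l\<close> is the same from every starting centre, the steps of \<open>l\<close> may be taken in any order, and no
  step rises by more than 1.  So every step of \<open>h\<close> in a direction used by \<open>l\<close> is a rise, at every
  centre: no edge crossed in that direction is in \<open>M\<close>.  But an alternating face has matching
  edges crossed in all three directions, so \<open>M\<close> would be trivial.
\<close>

section \<open>Directions, corners and faces of the hexagonal lattice\<close>

lemma hex_dir_simps [simp]:
  "hex_dir 0 = (1, 0)" "hex_dir 1 = (0, 1)" "hex_dir (Suc 0) = (0, 1)" "hex_dir 2 = (-1, 1)"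
  "hex_dir 3 = (-1, 0)" "hex_dir 4 = (0, -1)" "hex_dir 5 = (1, -1)"
  by (simp_all add: hex_dir_def)

lemma hex_dir_mod: "hex_dir (k mod 6) = hex_dir k"
  by (simp add: hex_dir_def)

lemma corner_mod: "corner c (k mod 6) = corner c k"
  unfolding corner_def by (metis hex_dir_mod mod_add_left_eq)

lemma hex_edge_mod: "hex_edge p q t c (k mod 6) = hex_edge p q t c k"
  unfolding hex_edge_def left_end_def right_end_def
  by (metis corner_mod mod_add_left_eq)

lemma corner_simps:
  "corner (x, y) 0 = (3 * x + 1, 3 * y + 1)" "corner (x, y) 1 = (3 * x - 1, 3 * y + 2)"
  "corner (x, y) 2 = (3 * x - 2, 3 * y + 1)" "corner (x, y) 3 = (3 * x - 1, 3 * y - 1)"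
  "corner (x, y) 4 = (3 * x + 1, 3 * y - 2)" "corner (x, y) 5 = (3 * x + 2, 3 * y - 1)"
  by (simp_all add: corner_def hex_dir_def)

lemma less_6_cases:
  fixes k :: nat
  assumes "k < 6"
  obtains "k = 0" | "k = 1" | "k = 2" | "k = 3" | "k = 4" | "k = 5"
  using assms by linarith

lemma corner_mod_eq: "k mod 6 = j mod 6 \<Longrightarrow> corner c k = corner c j"
  by (metis corner_mod)

text \<open>The same edge seen from the hexagon on its other side.\<close>

lemma hex_edge_reverse: "hex_edge p q t (c + hex_dir k) (k + 3) = hex_edge p q t c k"
proof -
  have *: "hex_edge p q t (c + hex_dir k) (k + 3) = hex_edge p q t c k" if "k < 6" for k
  proof (cases c)
    case (Pair x y)
    have c: "corner d 6 = corner d 0" "corner d 7 = corner d 1" "corner d 8 = corner d 2"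
      "corner d 9 = corner d 3" "corner d 10 = corner d 4" "corner d 11 = corner d 5"
      "corner d 12 = corner d 0" "corner d 13 = corner d 1" for d
      by (rule corner_mod_eq, simp)+
    show ?thesis using that
      by (cases rule: less_6_cases)
        (simp_all add: hex_edge_def left_end_def right_end_def Pair c corner_simps
          del: One_nat_def, auto simp: algebra_simps)
  qed
  have "hex_edge p q t (c + hex_dir k) (k + 3) = hex_edge p q t (c + hex_dir (k mod 6)) (k mod 6 + 3)"
    by (metis hex_dir_mod hex_edge_mod mod_add_left_eq)
  then show ?thesis using *[of "k mod 6"] by (simp add: hex_edge_mod)
qed

lemma hex_dir_opposite: "hex_dir k + hex_dir (k + 3) = 0"
proof -
  have *: "hex_dir 6 = hex_dir 0" "hex_dir 7 = hex_dir 1" "hex_dir 8 = hex_dir 2"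
    by (simp_all add: hex_dir_def)
  have "k mod 6 < 6" by simp
  then have "hex_dir (k mod 6) + hex_dir (k mod 6 + 3) = 0"
    by (cases rule: less_6_cases) (simp_all add: * zero_prod_def)
  then show ?thesis by (metis hex_dir_mod mod_add_left_eq)
qed

lemma hex_dir_turn: "hex_dir k + hex_dir (Suc (Suc k)) = hex_dir (Suc k)"
proof -
  have *: "hex_dir 6 = hex_dir 0" "hex_dir 7 = hex_dir 1"
    by (simp_all add: hex_dir_def)
  have 2: "hex_dir (Suc (Suc 0)) = (-1, 1)"
    by (simp flip: numeral_2_eq_2)
  have "k mod 6 < 6" by simp
  then have "hex_dir (k mod 6) + hex_dir (k mod 6 + 2) = hex_dir (k mod 6 + 1)"
    by (cases rule: less_6_cases) (simp_all add: * 2 del: One_nat_def)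
  then have "hex_dir k + hex_dir (k + 2) = hex_dir (Suc k)"
    by (metis hex_dir_mod mod_add_left_eq Suc_eq_plus1)
  then show ?thesis by simp
qed

text \<open>
  Every dual edge, possibly after reversal, points in one of the directions 0, 2, 4; arguments
  about edges are carried out for these and transferred by \<open>hex_edge_reverse\<close>.
\<close>

lemma even_direction_cases:
  fixes k :: nat
  obtains "even k" "k mod 6 \<in> {0, 2, 4}" | "odd k" "(k + 3) mod 6 \<in> {0, 2, 4}"
proof (cases "even k")
  case True
  then have "k mod 6 \<in> {0, 2, 4}" by simp presburger
  with True show ?thesis by (rule that(1))
next
  case False
  then have "(k + 3) mod 6 \<in> {0, 2, 4}" by simp presburger
  with False show ?thesis by (rule that(2))
qed

section \<open>Functions on the integer grid\<close>

lemma grid_constant: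
  fixes G :: "int \<times> int \<Rightarrow> 'a"
  assumes x: "\<And>c. G (c + (1, 0)) = G c" and y: "\<And>c. G (c + (0, 1)) = G c"
  shows "G c = G d"
proof -
  have *: "G (x, y) = G (0, 0)" for x y
  proof -
    have "G (x, y) = G (0, y)"
    proof (induction x rule: int_induct[of _ 0])
      case (step1 i) then show ?case using x[of "(i, y)"] by simp
    next
      case (step2 i) then show ?case using x[of "(i - 1, y)"] by simp
    qed simp
    also have "\<dots> = G (0, 0)"
    proof (induction y rule: int_induct[of _ 0])
      case (step1 i) then show ?case using y[of "(0, i)"] by simp
    next
      case (step2 i) then show ?case using y[of "(0, i - 1)"] by simp
    qed simp
    finally show ?thesis .
  qed
  show ?thesis by (metis * surj_pair)
qed

lemma int_antidifference:
  fixes f :: "int \<Rightarrow> int"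
  shows "\<exists>F. F 0 = 0 \<and> (\<forall>x. F (x + 1) = F x + f x)"
proof -
  let ?F = "\<lambda>x. if x \<ge> 0 then \<Sum>i\<in>{0..<x}. f i else - (\<Sum>i\<in>{x..<0}. f i)"
  have "?F (x + 1) = ?F x + f x" for x
  proof (cases "x \<ge> 0")
    case True
    then have "{0..<x + 1} = insert x {0..<x}" by auto
    then show ?thesis using True by simp
  next
    case False
    then have "{x..<0} = insert x {x + 1..<0}" by auto
    then show ?thesis using False by auto
  qed
  then show ?thesis by (intro exI[of _ ?F]) simp
qed

text \<open>
  Sum along the row \<open>y\<close> after summing along the column 0; vanishing curl makes the choice of path
  irrelevant.
\<close>

lemma grid_potential:
  fixes a b :: "int \<Rightarrow> int \<Rightarrow> int"
  assumes curl: "\<And>x y. a x y + b (x + 1) y = b x y + a x (y + 1)"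
  obtains H :: "int \<times> int \<Rightarrow> int" where
    "\<And>x y. H (x + 1, y) = H (x, y) + a x y" "\<And>x y. H (x, y + 1) = H (x, y) + b x y"
proof -
  have "\<exists>F. F 0 = 0 \<and> (\<forall>x. F (x + 1) = F x + a x y)" for y
    by (rule int_antidifference)
  then obtain F where F: "\<And>y. F y 0 = 0" "\<And>x y. F y (x + 1) = F y x + a x y"
    by metis
  obtain G where G: "G 0 = 0" "\<And>y. G (y + 1) = G y + b 0 y"
    using int_antidifference[of "b 0"] by metis
  show ?thesis
  proof (rule that[of "\<lambda>(x, y). F y x + G y"])
    fix x y
    have "F (y + 1) x + G (y + 1) = F y x + G y + b x y"
    proof (induction x rule: int_induct[of _ 0])
      case base then show ?case by (simp add: F G)
    next
      case (step1 i) then show ?case using F(2)[of y i] F(2)[of "y + 1" i] curl[of i y] by simp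
    next
      case (step2 i) then show ?case
        using F(2)[of y "i - 1"] F(2)[of "y + 1" "i - 1"] curl[of "i - 1" y] by simp
    qed
    then show "(case (x, y + 1) of (x, y) \<Rightarrow> F y x + G y) = (case (x, y) of (x, y) \<Rightarrow> F y x + G y) + b x y"
      by simp
  qed (simp add: F)
qed

section \<open>Vertices and edges of the toroidal polyhex\<close>

locale toroidal_polyhex =
  fixes p q t :: int
  assumes p: "p \<ge> 2" and q: "q \<ge> 2"
begin

abbreviation edge :: "int \<times> int \<Rightarrow> nat \<Rightarrow> hedge" where
  "edge \<equiv> hex_edge p q t"

definition periods :: "(int \<times> int) set" where
  "periods = {(m * p + n * t, n * q) | m n. True}"

lemma periods_zero [simp]: "0 \<in> periods"
  unfolding periods_def by (auto simp: zero_prod_def intro!: exI[of _ 0])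

lemma periods_uminus: "l \<in> periods \<Longrightarrow> - l \<in> periods"
  unfolding periods_def
  by clarsimp (metis (no_types, opaque_lifting) minus_add_distrib mult_minus_left diff_conv_add_uminus)

lemma periods_add: "l \<in> periods \<Longrightarrow> l' \<in> periods \<Longrightarrow> l + l' \<in> periods"
  unfolding periods_def
  by clarsimp (metis (no_types, opaque_lifting) add.assoc add.left_commute distrib_right)

lemma periods_diff: "l \<in> periods \<Longrightarrow> l' \<in> periods \<Longrightarrow> l - l' \<in> periods"
  using periods_add[of l "- l'"] periods_uminus by simp

lemma periods_sym: "c - d \<in> periods \<longleftrightarrow> d - c \<in> periods"
  using periods_uminus[of "c - d"] periods_uminus[of "d - c"] by auto

lemma periods_shift_iff:
  "l \<in> periods \<Longrightarrow> x + l - c \<in> periods \<longleftrightarrow> x - c \<in> periods"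
  using periods_add[of "x - c" l] periods_diff[of "x + l - c" l] by (auto simp: algebra_simps)

text \<open>
  As \<open>p, q \<ge> 2\<close>, adjacent hexagons are different on the torus; therefore the quotient has no
  parallel edges and every face has six different edges.
\<close>

lemma no_short_period:
  assumes "(a, b) \<in> periods" "\<bar>a\<bar> \<le> 1" "\<bar>b\<bar> \<le> 1"
  shows "a = 0 \<and> b = 0"
proof -
  obtain m n where mn: "a = m * p + n * t" "b = n * q"
    using assms(1) by (auto simp: periods_def)
  have "n = 0"
  proof (rule ccontr)
    assume "n \<noteq> 0"
    then have "\<bar>b\<bar> \<ge> 1 * q" unfolding mn abs_mult using q by (intro mult_mono) auto
    then show False using assms q by simp
  qed
  moreover have "m = 0"
  proof (rule ccontr)
    assume "m \<noteq> 0"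
    then have "\<bar>m * p\<bar> \<ge> 1 * p" unfolding abs_mult using p by (intro mult_mono) auto
    then show False using assms p mn \<open>n = 0\<close> by simp
  qed
  ultimately show ?thesis using mn by simp
qed

lemma hex_dir_not_period: "hex_dir k \<notin> periods"
proof -
  have "k mod 6 < 6" by simp
  then have "hex_dir (k mod 6) \<notin> periods"
    by (cases rule: less_6_cases) (use no_short_period in force)+
  then show ?thesis by (simp add: hex_dir_mod)
qed

lemma vertex_class_eq_iff:
  "vertex_class p q t u = vertex_class p q t v \<longleftrightarrow> (\<exists>l \<in> periods. u = v + l + l + l)"
proof -
  have vc: "vertex_class p q t v = {v + l + l + l | l. l \<in> periods}" for v
  proof -
    have *: "v + (3 * x, 3 * y) = v + (x, y) + (x, y) + (x, y)" for x y
      by (cases v) simp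
    show ?thesis unfolding vertex_class_def periods_def * by blast
  qed
  show ?thesis
  proof
    assume "vertex_class p q t u = vertex_class p q t v"
    moreover have "u \<in> vertex_class p q t u"
      unfolding vc using periods_zero by (metis (mono_tags, lifting) add.right_neutral mem_Collect_eq)
    ultimately show "\<exists>l \<in> periods. u = v + l + l + l" unfolding vc by blast
  next
    assume "\<exists>l \<in> periods. u = v + l + l + l"
    then obtain l where l: "l \<in> periods" "u = v + l + l + l" by blast
    have "u + m + m + m = v + (l + m) + (l + m) + (l + m)"
      "v + m + m + m = u + (m - l) + (m - l) + (m - l)" for m
      unfolding l by (simp_all add: algebra_simps)
    then show "vertex_class p q t u = vertex_class p q t v"
      unfolding vc using l periods_add periods_diff by blast
  qed
qed

text \<open>
  The two colour classes: each lattice vertex is the centroid of an upward triangle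
  \<open>c\<close>, \<open>c + (1, 0)\<close>, \<open>c + (0, 1)\<close> or of a downward triangle \<open>c\<close>, \<open>c + (0, 1)\<close>, \<open>c + (-1, 1)\<close>.
\<close>

definition up_vertex :: "int \<times> int \<Rightarrow> hvertex" where
  "up_vertex c = vertex_class p q t (corner c 0)"

definition down_vertex :: "int \<times> int \<Rightarrow> hvertex" where
  "down_vertex c = vertex_class p q t (corner c 1)"

lemma up_vertex_eq_iff: "up_vertex c = up_vertex d \<longleftrightarrow> c - d \<in> periods"
proof -
  have "corner c 0 = corner d 0 + l + l + l \<longleftrightarrow> c - d = l" for l
    by (cases c; cases d; cases l) (auto simp: corner_simps simp del: One_nat_def)
  then show ?thesis by (simp add: up_vertex_def vertex_class_eq_iff)
qed

lemma down_vertex_eq_iff: "down_vertex c = down_vertex d \<longleftrightarrow> c - d \<in> periods"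
proof -
  have "corner c 1 = corner d 1 + l + l + l \<longleftrightarrow> c - d = l" for l
    by (cases c; cases d; cases l) (auto simp: corner_simps simp del: One_nat_def)
  then show ?thesis by (simp add: down_vertex_def vertex_class_eq_iff)
qed

lemma up_neq_down [simp]: "up_vertex c \<noteq> down_vertex d" "down_vertex d \<noteq> up_vertex c"
proof -
  have "\<not> (\<exists>l\<in>periods. corner c 0 = corner d 1 + l + l + l)"
    by (cases c; cases d) (auto simp: corner_simps simp del: One_nat_def; presburger)
  then show "up_vertex c \<noteq> down_vertex d" 
    by (simp add: up_vertex_def down_vertex_def vertex_class_eq_iff)
  then show "down_vertex d \<noteq> up_vertex c" by simp
qed

lemma corner_5_0: "corner c (5::nat) = corner (c + (1, -1)) 1"
  and corner_2_0: "corner c (2::nat) = corner (c - (1, 0)) 0"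
  and corner_3_0: "corner c (3::nat) = corner (c - (0, 1)) 1"
  and corner_4_0: "corner c (4::nat) = corner (c - (0, 1)) 0"
  by (cases c; simp add: corner_simps del: One_nat_def)+

lemma edge_ends:
  "edge c 0 = {up_vertex c, down_vertex (c + (1, -1))}"
  "edge c 2 = {up_vertex (c - (1, 0)), down_vertex c}"
  "edge c 4 = {up_vertex (c - (0, 1)), down_vertex (c - (0, 1))}"
proof -
  have c: "corner c 7 = corner c 1" "corner c 9 = corner c 3"
    by (rule corner_mod_eq, simp)+
  show "edge c 0 = {up_vertex c, down_vertex (c + (1, -1))}"
  "edge c 2 = {up_vertex (c - (1, 0)), down_vertex c}"
  "edge c 4 = {up_vertex (c - (0, 1)), down_vertex (c - (0, 1))}"
    unfolding hex_edge_def left_end_def right_end_def up_vertex_def down_vertex_def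
    by (simp_all add: c corner_5_0 corner_2_0 corner_3_0 corner_4_0 del: One_nat_def)
qed

text \<open>
  Positions of the two end-triangles of \<open>edge c k\<close> relative to \<open>c\<close>, meaningful for
  \<open>k \<in> {0, 2, 4}\<close> only.
\<close>

definition up_offset :: "nat \<Rightarrow> int \<times> int" where
  "up_offset k = (if k = 0 then (0, 0) else if k = 2 then (-1, 0) else (0, -1))"

definition down_offset :: "nat \<Rightarrow> int \<times> int" where
  "down_offset k = (if k = 0 then (1, -1) else if k = 2 then (0, 0) else (0, -1))"

lemma edge_conv:
  assumes "k \<in> {0, 2, 4}"
  shows "edge c k = {up_vertex (c + up_offset k), down_vertex (c + down_offset k)}"
  using assms by (cases c) (auto simp: up_offset_def down_offset_def edge_ends)

text \<open>
  Equal edges have equal upward ends and equal downward ends modulo periods.  For edges crossed in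
  different directions the two congruences differ by a lattice unit vector, which is not a period.
\<close>

lemma edge_eq_iff:
  assumes "j \<in> {0, 2, 4}" "k \<in> {0, 2, 4}"
  shows "edge c j = edge d k \<longleftrightarrow> j = k \<and> c - d \<in> periods"
proof (cases "j = k")
  case True
  then show ?thesis
    by (simp add: edge_conv[OF assms(1)] edge_conv[OF assms(2)] doubleton_eq_iff
        up_vertex_eq_iff down_vertex_eq_iff)
next
  case False
  have "\<not> edge c j = edge d k"
  proof
    assume "edge c j = edge d k"
    then have "c + up_offset j - (d + up_offset k) \<in> periods"
      "c + down_offset j - (d + down_offset k) \<in> periods"
      by (simp_all add: edge_conv[OF assms(1)] edge_conv[OF assms(2)] doubleton_eq_iff
        up_vertex_eq_iff down_vertex_eq_iff)
    then have "c + up_offset j - (d + up_offset k) - (c + down_offset j - (d + down_offset k)) \<in> periods"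
      by (rule periods_diff)
    then have "(up_offset j - up_offset k) - (down_offset j - down_offset k) \<in> periods"
      by (simp add: algebra_simps)
    with assms False show False
      by (auto simp: up_offset_def down_offset_def dest!: no_short_period)
  qed
  with False show ?thesis by simp
qed

lemma edge_period: "l \<in> periods \<Longrightarrow> edge (c + l) k = edge c k"
proof (cases k rule: even_direction_cases)
  case 1
  assume "l \<in> periods"
  with 1 show ?thesis
    using edge_eq_iff[of "k mod 6" "k mod 6" "c + l" c] by (simp add: hex_edge_mod)
next
  case 2
  assume "l \<in> periods"
  with 2 have "edge (c + l + hex_dir k) ((k + 3) mod 6) = edge (c + hex_dir k) ((k + 3) mod 6)"
    using edge_eq_iff[of "(k + 3) mod 6" "(k + 3) mod 6" "c + l + hex_dir k" "c + hex_dir k"] by simp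
  then show ?thesis by (simp add: hex_edge_mod hex_edge_reverse)
qed

lemma H_edges_eq: "H_edges p q t = {edge c k | c k. k \<in> {0, 2, 4}}"
proof -
  have "\<exists>d. \<exists>j \<in> {0, 2, 4}. edge c k = edge d j" for c k
    by (cases k rule: even_direction_cases) (metis hex_edge_mod hex_edge_reverse)+
  then show ?thesis unfolding H_edges_def by blast
qed

lemma H_verts_eq: "H_verts p q t = range up_vertex \<union> range down_vertex"
proof -
  have "vertex_class p q t (corner c k) \<in> range up_vertex \<union> range down_vertex" for c k
  proof -
    have "k mod 6 < 6" by simp
    then have "vertex_class p q t (corner c (k mod 6)) \<in> range up_vertex \<union> range down_vertex"
      by (cases rule: less_6_cases) (simp_all only: corner_5_0 corner_2_0 corner_3_0 corner_4_0
        flip: up_vertex_def down_vertex_def, auto)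
    then show ?thesis by (simp add: corner_mod)
  qed
  then show ?thesis unfolding H_verts_def by (auto simp: up_vertex_def down_vertex_def)
qed

lemma up_vertex_in_edge:
  assumes "e \<in> H_edges p q t"
  shows "up_vertex d \<in> e \<longleftrightarrow> (\<exists>k \<in> {0, 2, 4}. e = edge (d - up_offset k) k)"
proof -
  obtain c j where e: "j \<in> {0, 2, 4}" "e = edge c j" using assms by (auto simp: H_edges_eq)
  have "up_vertex d \<in> e \<longleftrightarrow> c - (d - up_offset j) \<in> periods"
    using periods_sym[of d] by (simp add: e(2) edge_conv[OF e(1)] up_vertex_eq_iff diff_diff_eq2)
  also have "\<dots> \<longleftrightarrow> (\<exists>k \<in> {0, 2, 4}. e = edge (d - up_offset k) k)"
    using edge_eq_iff[OF e(1)] e by metis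
  finally show ?thesis .
qed

lemma down_vertex_in_edge:
  assumes "e \<in> H_edges p q t"
  shows "down_vertex d \<in> e \<longleftrightarrow> (\<exists>k \<in> {0, 2, 4}. e = edge (d - down_offset k) k)"
proof -
  obtain c j where e: "j \<in> {0, 2, 4}" "e = edge c j" using assms by (auto simp: H_edges_eq)
  have "down_vertex d \<in> e \<longleftrightarrow> c - (d - down_offset j) \<in> periods"
    using periods_sym[of d] by (simp add: e(2) edge_conv[OF e(1)] down_vertex_eq_iff diff_diff_eq2)
  also have "\<dots> \<longleftrightarrow> (\<exists>k \<in> {0, 2, 4}. e = edge (d - down_offset k) k)"
    using edge_eq_iff[OF e(1)] e by metis
  finally show ?thesis .
qed

section \<open>Height functions of perfect matchings\<close>

text \<open>
  Rise of the height along a dual edge of direction 0, 2 or 4.  Three such numbers sum to zero iff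
  exactly one of the three edges is in \<open>M\<close>.
\<close>

definition tile_step :: "hedge set \<Rightarrow> int \<times> int \<Rightarrow> nat \<Rightarrow> int" where
  "tile_step M c k = (if edge c k \<in> M then -2 else 1)"

lemma unique_edge_iff:
  assumes M: "M \<subseteq> H_edges p q t"
    and v: "\<And>e. e \<in> H_edges p q t \<Longrightarrow> v \<in> e \<longleftrightarrow> (\<exists>k \<in> {0, 2, 4}. e = edge (f k) k)"
  shows "(\<exists>!e. e \<in> M \<and> v \<in> e) \<longleftrightarrow> tile_step M (f 0) 0 + tile_step M (f 2) 2 + tile_step M (f 4) 4 = 0"
proof -
  have inj: "edge (f 0) 0 \<noteq> edge (f 2) 2" "edge (f 2) 2 \<noteq> edge (f 4) 4" "edge (f 0) 0 \<noteq> edge (f 4) 4"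
    by (simp_all add: edge_eq_iff)
  have "e \<in> M \<and> v \<in> e \<longleftrightarrow> e \<in> M \<and> (e = edge (f 0) 0 \<or> e = edge (f 2) 2 \<or> e = edge (f 4) 4)" for e
    using v M by auto
  then have "(\<exists>!e. e \<in> M \<and> v \<in> e) \<longleftrightarrow>
    (\<exists>!e. e \<in> M \<and> (e = edge (f 0) 0 \<or> e = edge (f 2) 2 \<or> e = edge (f 4) 4))" by simp
  also have "\<dots> \<longleftrightarrow> tile_step M (f 0) 0 + tile_step M (f 2) 2 + tile_step M (f 4) 4 = 0"
    unfolding tile_step_def using inj by (auto split: if_splits)
  finally show ?thesis .
qed

lemma perfect_matching_iff:
  "perfect_matching p q t M \<longleftrightarrow> M \<subseteq> H_edges p q t \<and>
    (\<forall>d. tile_step M d 0 + tile_step M (d + (1, 0)) 2 + tile_step M (d + (0, 1)) 4 = 0) \<and>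
    (\<forall>d. tile_step M (d + (-1, 1)) 0 + tile_step M d 2 + tile_step M (d + (0, 1)) 4 = 0)"
proof (cases "M \<subseteq> H_edges p q t")
  case True
  have off: "d - up_offset 0 = d" "d - up_offset 2 = d + (1, 0)" "d - up_offset 4 = d + (0, 1)"
    "d - down_offset 0 = d + (-1, 1)" "d - down_offset 2 = d" "d - down_offset 4 = d + (0, 1)" for d
    by (cases d; simp add: up_offset_def down_offset_def)+
  have "(\<forall>v \<in> range up_vertex \<union> range down_vertex. P v) \<longleftrightarrow>
    (\<forall>d. P (up_vertex d)) \<and> (\<forall>d. P (down_vertex d))" for P
    by blast
  then show ?thesis
    using True unique_edge_iff[OF True up_vertex_in_edge] unique_edge_iff[OF True down_vertex_in_edge]
    unfolding perfect_matching_def H_verts_eq off by simp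
qed (simp add: perfect_matching_def)

text \<open>
  A height lives on the plane, not on the torus: only its steps are invariant under translations.
\<close>

definition height :: "(int \<times> int \<Rightarrow> int) \<Rightarrow> hedge set \<Rightarrow> bool" where
  "height h M \<longleftrightarrow> M \<subseteq> H_edges p q t \<and>
    (\<forall>c. \<forall>k \<in> {0, 2, 4}. h (c + hex_dir k) = h c + tile_step M c k)"

lemma height_imp_perfect_matching:
  assumes "height h M"
  shows "perfect_matching p q t M"
proof -
  have "h (c + hex_dir k) = h c + tile_step M c k" if "k \<in> {0, 2, 4}" for c k
    using assms that unfolding height_def by blast
  from this[of 0] this[of 2] this[of 4]
  have s: "tile_step M c 0 = h (c + (1, 0)) - h c" "tile_step M c 2 = h (c + (-1, 1)) - h c"
    "tile_step M c 4 = h (c + (0, -1)) - h c" for c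
    by simp_all
  show ?thesis
    using assms unfolding perfect_matching_iff height_def s by auto
qed

text \<open>
  Going up a column is going against direction 4, whence the minus sign below.  The curl of the
  prescribed differences around a unit square is the difference of the sums around an upward and a
  downward triangle sharing the side of direction 2.
\<close>

lemma perfect_matching_imp_height:
  assumes "perfect_matching p q t M"
  shows "\<exists>h. height h M"
proof -
  let ?s = "tile_step M"
  have up: "?s (x, y) 0 + ?s (x + 1, y) 2 + ?s (x, y + 1) 4 = 0"
    and down: "?s (x - 1, y + 1) 0 + ?s (x, y) 2 + ?s (x, y + 1) 4 = 0" for x y
    using assms unfolding perfect_matching_iff by (auto dest: spec[of _ "(x, y)"])
  have "?s (x, y) 0 + - ?s (x + 1, y + 1) 4 = - ?s (x, y + 1) 4 + ?s (x, y + 1) 0" for x y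
    using up[of x y] down[of "x + 1" y] by simp
  then obtain h where h: "\<And>x y. h (x + 1, y) = h (x, y) + ?s (x, y) 0"
      "\<And>x y. h (x, y + 1) = h (x, y) - ?s (x, y + 1) 4"
    using grid_potential[of "\<lambda>x y. ?s (x, y) 0" "\<lambda>x y. - ?s (x, y + 1) 4"]
    by auto
  have "h (c + hex_dir k) = h c + ?s c k" if "k \<in> {0, 2, 4}" for c k
  proof (cases c)
    case (Pair x y)
    show ?thesis
      using that h(1)[of x y] h(1)[of "x - 1" "y + 1"] h(2)[of x y] h(2)[of x "y - 1"] down[of x y]
      by (auto simp: Pair)
  qed
  then show ?thesis using assms unfolding height_def perfect_matching_def by blast
qed

lemma tile_step_mod: "tile_step M c (k mod 6) = tile_step M c k"
  by (simp add: tile_step_def hex_edge_mod)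

lemma tile_step_reverse: "tile_step M (c + hex_dir k) (k + 3) = tile_step M c k"
  by (simp add: tile_step_def hex_edge_reverse)

lemma height_step:
  assumes "height h M"
  shows "h (c + hex_dir k) = h c + (if even k then tile_step M c k else - tile_step M c k)"
proof -
  have h: "h (c + hex_dir j) = h c + tile_step M c j" if "j mod 6 \<in> {0, 2, 4}" for c j
    using assms that unfolding height_def by (metis hex_dir_mod tile_step_mod)
  show ?thesis
  proof (cases k rule: even_direction_cases)
    case 1
    then show ?thesis using h[of k c] by simp
  next
    case 2
    then show ?thesis using h[of "k + 3" "c + hex_dir k"]
      by (simp add: tile_step_reverse hex_dir_opposite add.assoc)
  qed
qed

lemma tile_step_period: "l \<in> periods \<Longrightarrow> tile_step M (c + l) k = tile_step M c k"
  by (simp add: tile_step_def edge_period)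

text \<open>
  The steps are periodic, so translating a height by a period gives another height of the same
  matching, which differs from it by a constant.
\<close>

lemma height_period:
  assumes "height h M" "l \<in> periods"
  shows "h (c + l) - h c = h (d + l) - h d"
proof (rule grid_constant[where G = "\<lambda>c. h (c + l) - h c"])
  fix c
  have "h (c + hex_dir k + l) - h (c + hex_dir k) = h (c + l) - h c" for k
    using height_step[OF assms(1), of "c + l" k] height_step[OF assms(1), of c k]
    by (simp add: tile_step_period[OF assms(2)] add_ac)
  from this[of 0] this[of 1]
  show "h (c + (1, 0) + l) - h (c + (1, 0)) = h (c + l) - h c"
    "h (c + (0, 1) + l) - h (c + (0, 1)) = h (c + l) - h c" by simp_all
qed

lemma height_unique:
  assumes "height h M" "height h N"
  shows "M = N"
proof -
  have "edge c k \<in> M \<longleftrightarrow> edge c k \<in> N" for c k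
    using height_step[OF assms(1), of c k] height_step[OF assms(2), of c k]
    by (auto simp: tile_step_def split: if_splits)
  moreover have "M \<subseteq> H_edges p q t" "N \<subseteq> H_edges p q t" using assms by (auto simp: height_def)
  ultimately show ?thesis unfolding H_edges_def by blast
qed

lemma height_shift: "height h M \<Longrightarrow> height (\<lambda>x. h x + a) M"
  by (simp add: height_def)

section \<open>Rotating an alternating face\<close>

lemma edge_in_face_iff:
  "edge d k \<in> face_edges p q t c \<longleftrightarrow> d - c \<in> periods \<or> d + hex_dir k - c \<in> periods"
proof -
  have face: "face_edges p q t c = {edge c j | j. True}"
  proof -
    have "edge c j \<in> face_edges p q t c" for j
      unfolding face_edges_def using hex_edge_mod[of p q t c j] by (metis atLeastLessThan_iff
        bot_nat_0.extremum image_eqI mod_less_divisor zero_less_numeral)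
    then show ?thesis unfolding face_edges_def by blast
  qed
  have *: "edge d k \<in> face_edges p q t c \<longleftrightarrow> d - c \<in> periods \<or> d + hex_dir k - c \<in> periods"
    if k: "k \<in> {0, 2, 4}" for d k
  proof
    assume "edge d k \<in> face_edges p q t c"
    then obtain j where j: "edge d k = edge c j" by (auto simp: face)
    show "d - c \<in> periods \<or> d + hex_dir k - c \<in> periods"
    proof (cases j rule: even_direction_cases)
      case 1
      then show ?thesis using j edge_eq_iff[OF k, of "j mod 6" d c] by (simp add: hex_edge_mod)
    next
      case 2
      then have "edge d k = edge (c + hex_dir j) ((j + 3) mod 6)"
        using j by (simp add: hex_edge_mod hex_edge_reverse)
      then have "k = (j + 3) mod 6" "d - (c + hex_dir j) \<in> periods"
        using 2 edge_eq_iff[OF k, of "(j + 3) mod 6"] by auto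
      moreover have "hex_dir j = - hex_dir ((j + 3) mod 6)"
        using hex_dir_opposite[of j] by (simp add: hex_dir_mod eq_neg_iff_add_eq_0)
      ultimately show ?thesis by (simp add: algebra_simps)
    qed
  next
    assume "d - c \<in> periods \<or> d + hex_dir k - c \<in> periods"
    then show "edge d k \<in> face_edges p q t c"
    proof
      assume "d - c \<in> periods"
      then have "edge d k = edge c k" using edge_period[of "d - c" c k] by simp
      then show ?thesis by (auto simp: face)
    next
      assume "d + hex_dir k - c \<in> periods"
      then have "edge (d + hex_dir k) (k + 3) = edge c (k + 3)"
        using edge_period[of "d + hex_dir k - c" c "k + 3"] by simp
      then show ?thesis by (auto simp: face hex_edge_reverse)
    qed
  qed
  show ?thesis
  proof (cases k rule: even_direction_cases)
    case 1
    then show ?thesis using *[of "k mod 6" d] by (simp add: hex_edge_mod hex_dir_mod)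
  next
    case 2
    then show ?thesis using *[of "(k + 3) mod 6" "d + hex_dir k"]
      by (auto simp: hex_edge_mod hex_dir_mod hex_edge_reverse hex_dir_opposite add.assoc)
  qed
qed

lemma alternating_face_iff:
  "alternating_face p q t M c \<longleftrightarrow> (\<exists>b. \<forall>k. edge c k \<in> M \<longleftrightarrow> (even k \<longleftrightarrow> b))"
proof
  assume alt: "alternating_face p q t M c"
  have step: "edge c (Suc k) \<in> M \<longleftrightarrow> edge c k \<notin> M" for k
  proof -
    have "k mod 6 < 6" by simp
    then have "edge c (k mod 6) \<in> M \<longleftrightarrow> edge c (k mod 6 + 1) \<notin> M"
      using alt unfolding alternating_face_def by blast
    then show ?thesis by (metis Suc_eq_plus1 hex_edge_mod mod_add_left_eq)
  qed
  have "edge c k \<in> M \<longleftrightarrow> (even k \<longleftrightarrow> edge c 0 \<in> M)" for k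
  proof (induction k)
    case (Suc k)
    then show ?case unfolding step by auto
  qed simp
  then show "\<exists>b. \<forall>k. edge c k \<in> M \<longleftrightarrow> (even k \<longleftrightarrow> b)" by blast
next
  assume "\<exists>b. \<forall>k. edge c k \<in> M \<longleftrightarrow> (even k \<longleftrightarrow> b)"
  then obtain b where b: "\<And>k. edge c k \<in> M \<longleftrightarrow> (even k \<longleftrightarrow> b)" by blast
  show "alternating_face p q t M c" unfolding alternating_face_def b by simp
qed

text \<open>
  \<open>b\<close> says that the edges crossed when leaving \<open>c\<close> in the directions 0, 2, 4 are matched.  Then
  all oriented steps out of \<open>c\<close> fall by 2 and all oriented steps into \<open>c\<close> rise by 1, so \<open>c\<close> is a
  local maximum; the rotation exchanges the two kinds of steps, which lowers \<open>c\<close> by 3.  Otherwise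
  \<open>c\<close> is a local minimum and is raised by 3.
\<close>

lemma height_flip:
  assumes h: "height h M"
    and alt: "\<And>k. edge c k \<in> M \<longleftrightarrow> (even k \<longleftrightarrow> b)"
    and N: "(M - N) \<union> (N - M) = face_edges p q t c"
  shows "height (\<lambda>x. h x + (if x - c \<in> periods then if b then -3 else 3 else 0)) N"
  unfolding height_def
proof (intro conjI allI ballI)
  have "face_edges p q t c \<subseteq> H_edges p q t" unfolding face_edges_def H_edges_def by fast
  then show "N \<subseteq> H_edges p q t" using N h unfolding height_def by blast
  fix d and k :: nat
  assume k: "k \<in> {0, 2, 4}"
  have N_iff: "e \<in> N \<longleftrightarrow> (e \<in> M \<longleftrightarrow> e \<notin> face_edges p q t c)" for e using N by blast
  have ev: "even k" using k by auto
  then have hd: "h (d + hex_dir k) = h d + tile_step M d k" using height_step[OF h, of d k] by simp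
  consider "d - c \<in> periods" "d + hex_dir k - c \<notin> periods"
    | "d - c \<notin> periods" "d + hex_dir k - c \<in> periods"
    | "d - c \<notin> periods" "d + hex_dir k - c \<notin> periods"
    using periods_diff[of "d + hex_dir k - c" "d - c"] hex_dir_not_period[of k] by auto
  then show "h (d + hex_dir k) + (if d + hex_dir k - c \<in> periods then if b then -3 else 3 else 0) =
    h d + (if d - c \<in> periods then if b then -3 else 3 else 0) + tile_step N d k"
  proof cases
    case 1
    then have "edge d k = edge c k" using edge_period[of "d - c" c k] by simp
    then have "edge d k \<in> M \<longleftrightarrow> b" using alt[of k] ev by simp
    then show ?thesis using 1 hd by (auto simp: tile_step_def N_iff edge_in_face_iff)
  next
    case 2
    then have "edge d k = edge c (k + 3)"
      using edge_period[of "d + hex_dir k - c" c "k + 3"] by (simp add: hex_edge_reverse)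
    then have "edge d k \<in> M \<longleftrightarrow> \<not> b" using alt[of "k + 3"] ev by simp
    then show ?thesis using 2 hd by (auto simp: tile_step_def N_iff edge_in_face_iff)
  next
    case 3
    then show ?thesis using hd by (auto simp: tile_step_def N_iff edge_in_face_iff)
  qed
qed

text \<open>
  Adjacency in the resonance graph only asks that the symmetric difference be a face.  The edges
  joining neighbours of \<open>c\<close> are outside the face, so the difference of the two heights is constant
  on the ring around \<open>c\<close>; it jumps by 3 or -3 from \<open>c\<close> to the ring, and the sign of this single
  jump decides which edges of the face are in \<open>M\<close>.
\<close>

lemma resonance_face_alternating:
  assumes h: "height h M" and g: "height g N"
    and N: "(M - N) \<union> (N - M) = face_edges p q t c"
  shows "\<exists>b. \<forall>k. edge c k \<in> M \<longleftrightarrow> (even k \<longleftrightarrow> b)"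
proof -
  define D where "D x = g x - h x" for x
  have N_iff: "e \<in> N \<longleftrightarrow> (e \<in> M \<longleftrightarrow> e \<notin> face_edges p q t c)" for e using N by blast
  have "D (c + hex_dir (Suc k)) = D (c + hex_dir k)" for k
  proof -
    have "edge (c + hex_dir k) (k + 2) \<notin> face_edges p q t c"
      unfolding edge_in_face_iff using hex_dir_not_period[of k] hex_dir_not_period[of "Suc k"]
      by (simp add: add.assoc hex_dir_turn)
    then have "tile_step N (c + hex_dir k) (k + 2) = tile_step M (c + hex_dir k) (k + 2)"
      by (simp add: tile_step_def N_iff)
    then show ?thesis
      using height_step[OF h, of "c + hex_dir k" "k + 2"] height_step[OF g, of "c + hex_dir k" "k + 2"]
      by (simp add: D_def add.assoc hex_dir_turn)
  qed
  then have ring: "D (c + hex_dir k) = D (c + hex_dir 0)" for k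
    by (induction k) (simp_all del: hex_dir_simps)
  have "edge c k \<in> M \<longleftrightarrow> (even k \<longleftrightarrow> D (c + hex_dir 0) - D c = 3)" for k
  proof -
    have "edge c k \<in> face_edges p q t c" by (simp add: edge_in_face_iff)
    then show ?thesis
      using height_step[OF h, of c k] height_step[OF g, of c k] ring[of k]
      by (auto simp: D_def tile_step_def N_iff split: if_splits)
  qed
  then show ?thesis by blast
qed

lemma resonance_height:
  assumes "(M, N) \<in> resonance_adj p q t" and h: "height h M"
  shows "\<exists>g. height g N \<and> (\<forall>x. \<forall>l \<in> periods. g (x + l) - g x = h (x + l) - h x)"
proof -
  obtain c where N: "(M - N) \<union> (N - M) = face_edges p q t c" "perfect_matching p q t N"
    using assms by (auto simp: resonance_adj_def)
  obtain b where "\<And>k. edge c k \<in> M \<longleftrightarrow> (even k \<longleftrightarrow> b)"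
    using resonance_face_alternating[OF h _ N(1)] perfect_matching_imp_height[OF N(2)] by blast
  from height_flip[OF h this N(1)]
  have "height (\<lambda>x. h x + (if x - c \<in> periods then if b then -3 else 3 else 0)) N" .
  then show ?thesis
    by (intro exI[of _ "\<lambda>x. h x + (if x - c \<in> periods then if b then -3 else 3 else 0)"])
      (simp add: periods_shift_iff)
qed

section \<open>Flow as an increment of the height\<close>

lemma height_walk:
  assumes "height h M"
  shows "h (c + sum_list (map hex_dir ks)) - h c =
    (\<Sum>(d, k)\<leftarrow>darts c ks. if even k then 1 else -1) -
    3 * (\<Sum>(d, k)\<leftarrow>darts c ks. if edge d k \<in> M then if even k then 1 else -1 else 0)"
proof (induction ks arbitrary: c)
  case (Cons k ks)
  show ?case
    using Cons.IH[of "c + hex_dir k"] height_step[OF assms, of c k]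
    by (auto simp: tile_step_def add.assoc)
qed simp

text \<open>
  A proper colouring is constant on the upward vertices and takes the other value on the downward
  ones, so only the colour of one vertex matters: it fixes the sign of the flow.
\<close>

lemma colour_up_down:
  assumes "proper_colouring p q t white"
  shows "white (left_end p q t c k) \<longleftrightarrow> (even k \<longleftrightarrow> white (up_vertex 0))"
    and "white (right_end p q t c k) \<longleftrightarrow> \<not> white (left_end p q t c k)"
proof -
  let ?w = "\<lambda>c k. white (vertex_class p q t (corner c k))"
  have right: "white (right_end p q t c k) \<longleftrightarrow> \<not> white (left_end p q t c k)" for c k
  proof -
    have "{left_end p q t c k, right_end p q t c k} \<in> H_edges p q t"
      unfolding H_edges_def hex_edge_def by blast
    then show ?thesis using assms unfolding proper_colouring_def by blast
  qed
  then show "white (right_end p q t c k) \<longleftrightarrow> \<not> white (left_end p q t c k)" .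
  have suc: "?w c (Suc k) \<longleftrightarrow> \<not> ?w c k" for c k
  proof -
    have "corner c (Suc k + 5) = corner c k" by (rule corner_mod_eq) simp
    then show ?thesis using right[of c "Suc k"] unfolding left_end_def right_end_def by simp
  qed
  have parity: "?w c k \<longleftrightarrow> (even k \<longleftrightarrow> ?w c 0)" for c k
    by (induction k) (auto simp: suc)
  have "corner (c + (1, 0)) 2 = corner c 0" "corner (c + (0, 1)) 4 = corner c 0" for c
    by (cases c; simp add: corner_simps)+
  then have "?w (c + (1, 0)) 0 = ?w c 0" "?w (c + (0, 1)) 0 = ?w c 0" for c
    using parity[of "c + (1, 0)" 2] parity[of "c + (0, 1)" 4] by simp_all
  then have "?w c 0 = ?w 0 0"
    by (rule grid_constant[where G = "\<lambda>c. ?w c 0"])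
  then show "white (left_end p q t c k) \<longleftrightarrow> (even k \<longleftrightarrow> white (up_vertex 0))"
    using parity[of c k] by (simp add: left_end_def up_vertex_def)
qed

lemma card_image_filter:
  assumes "distinct (map f xs)"
  shows "int (card (f ` {x \<in> set xs. P x})) = (\<Sum>x\<leftarrow>xs. if P x then 1 else 0)"
  using assms
proof (induction xs)
  case (Cons a xs)
  have "{x \<in> set (a # xs). P x} = (if P a then insert a {x \<in> set xs. P x} else {x \<in> set xs. P x})"
    by auto
  moreover have "f a \<notin> f ` {x \<in> set xs. P x}" using Cons.prems by auto
  ultimately show ?case using Cons by simp
qed simp

text \<open>
  A dual cycle crosses no edge twice, so the cardinalities in the flow may be counted along the
  walk, with a sign given by the parity of the direction of each step.
\<close>

lemma flow_eq_sum:
  assumes col: "proper_colouring p q t white" and L: "dual_cycle p q t L"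
  shows "flow p q t white L M = (if white (up_vertex 0) then 1 else -1) *
    (\<Sum>(d, k)\<leftarrow>walk_darts L. if edge d k \<in> M then if even k then 1 else -1 else 0)"
proof -
  have dist: "distinct (map (\<lambda>(c, k). edge c k) (walk_darts L))"
    using L by (simp add: dual_cycle_def)
  have signs: "(\<Sum>(d, k)\<leftarrow>ds. if edge d k \<in> M then if even k then 1 else -1 else 0 :: int) =
      (\<Sum>(c, k)\<leftarrow>ds. if even k \<and> edge c k \<in> M then 1 else 0) -
      (\<Sum>(c, k)\<leftarrow>ds. if odd k \<and> edge c k \<in> M then 1 else 0)" for ds
    by (induction ds) auto
  let ?E = "\<lambda>(c, k). edge c k"
  let ?crossed = "\<lambda>P. {x \<in> set (walk_darts L). (\<lambda>(c, k). white (P c k) \<and> edge c k \<in> M) x}"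
  have "crossed_pos p q t white L \<inter> M = ?E ` ?crossed (left_end p q t)"
    "crossed_neg p q t white L \<inter> M = ?E ` ?crossed (right_end p q t)"
    unfolding crossed_pos_def crossed_neg_def by force+
  then have "flow p q t white L M =
      (\<Sum>(c, k)\<leftarrow>walk_darts L. if white (left_end p q t c k) \<and> edge c k \<in> M then 1 else 0) -
      (\<Sum>(c, k)\<leftarrow>walk_darts L. if white (right_end p q t c k) \<and> edge c k \<in> M then 1 else 0)"
    unfolding flow_def using card_image_filter[OF dist] by (simp add: case_prod_unfold)
  also have "\<dots> = (if white (up_vertex 0) then 1 else -1) *
    (\<Sum>(d, k)\<leftarrow>walk_darts L. if edge d k \<in> M then if even k then 1 else -1 else 0)"
    unfolding colour_up_down(2)[OF col] colour_up_down(1)[OF col]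
    using signs[of "walk_darts L"] by (simp split: if_splits)
  finally show ?thesis .
qed

lemma flow_eq_iff_height:
  assumes "proper_colouring p q t white" "dual_cycle p q t L" "height h M" "height g N"
  shows "flow p q t white L M = flow p q t white L N \<longleftrightarrow>
    h (fst L + displacement L) - h (fst L) = g (fst L + displacement L) - g (fst L)"
  unfolding flow_eq_sum[OF assms(1,2)] displacement_def height_walk[OF assms(3)] height_walk[OF assms(4)]
  by (auto simp: walk_darts_def)

lemma resonance_flow:
  assumes col: "proper_colouring p q t white" and L: "dual_cycle p q t L"
    and "(M, N) \<in> (resonance_adj p q t)\<^sup>*"
  shows "flow p q t white L M = flow p q t white L N"
  using assms(3)
proof (induction rule: rtrancl_induct)
  case (step N K)
  have "perfect_matching p q t N" using step(2) by (simp add: resonance_adj_def)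
  then obtain h where h: "height h N" using perfect_matching_imp_height by blast
  obtain g where g: "height g K" "\<And>x l. l \<in> periods \<Longrightarrow> g (x + l) - g x = h (x + l) - h x"
    using resonance_height[OF step(2) h] by blast
  have "displacement L \<in> periods"
    using L by (auto simp: dual_cycle_def has_winding_vector_def periods_def)
  then have "flow p q t white L N = flow p q t white L K"
    using flow_eq_iff_height[OF col L h g(1)] g(2) by simp
  then show ?case using step.IH by simp
qed simp

section \<open>Raising local minima\<close>

text \<open>Finitely many centres represent all classes modulo the periods.\<close>

definition residue :: "int \<times> int \<Rightarrow> int \<times> int" where
  "residue c = ((fst c - snd c div q * t) mod p, snd c mod q)"

abbreviation residues :: "(int \<times> int) set" where
  "residues \<equiv> {0..<p} \<times> {0..<q}"

lemma residue_in_residues: "residue c \<in> residues"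
  using p q by (simp add: residue_def)

lemma residue_congruent: "c - residue c \<in> periods"
proof -
  obtain x y where c: "c = (x, y)" by (cases c)
  have "(x - y div q * t) = (x - y div q * t) div p * p + (x - y div q * t) mod p" by simp
  moreover have "y = y div q * q + y mod q" by simp
  ultimately have "c - residue c = ((x - y div q * t) div p * p + y div q * t, y div q * q)"
    unfolding residue_def c by (simp add: algebra_simps)
  then show ?thesis unfolding periods_def by blast
qed

text \<open>
  If the steps into \<open>c\<close> all cross matching edges, then in every triangle at \<open>c\<close> the matching edge
  is already used up, so the steps out of \<open>c\<close> cross none.
\<close>

lemma local_minimum_face:
  assumes "height h M" and inc: "\<And>k. k \<in> {0, 2, 4} \<Longrightarrow> edge (c - hex_dir k) k \<in> M"
  shows "edge c k \<in> M \<longleftrightarrow> odd k"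
proof (cases k rule: even_direction_cases)
  case 1
  have pm: "\<And>d. tile_step M d 0 + tile_step M (d + (1, 0)) 2 + tile_step M (d + (0, 1)) 4 = 0"
    "\<And>d. tile_step M (d + (-1, 1)) 0 + tile_step M d 2 + tile_step M (d + (0, 1)) 4 = 0"
    using height_imp_perfect_matching[OF assms(1)] unfolding perfect_matching_iff by blast+
  have "tile_step M (c + (0, 1)) 4 = -2" "tile_step M (c + (1, -1)) 2 = -2"
    using inc[of 4] inc[of 2] by (cases c; simp add: tile_step_def)+
  then have "edge c 0 \<notin> M" "edge c 2 \<notin> M" "edge c 4 \<notin> M"
    using pm(1)[of c] pm(2)[of c] pm(1)[of "c + (0, -1)"]
    by (cases c; auto simp: tile_step_def split: if_splits)+
  then show ?thesis using 1 hex_edge_mod[of p q t c k] by auto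
next
  case 2
  have "hex_dir (k + 3) = - hex_dir k"
    using hex_dir_opposite[of k] by (simp add: eq_neg_iff_add_eq_0 add.commute)
  then have "edge (c - hex_dir ((k + 3) mod 6)) ((k + 3) mod 6) = edge c k"
    by (simp add: hex_edge_mod hex_dir_mod hex_edge_reverse)
  then show ?thesis using inc[OF 2(2)] 2 by simp
qed

text \<open>
  This is where nontriviality enters.  If all centres with \<open>h c < g c\<close> had a predecessor one step lower, an
  infinite descent would close up on the torus and yield a period along which \<open>h\<close> rises as
  fast as possible, which forbids matching edges in a whole direction.
\<close>

lemma exists_local_minimum:
  assumes h: "height h M" and g: "height g N"
    and alt: "alternating_face p q t M a" and x: "h x < g x"
  shows "\<exists>c. h c < g c \<and> (\<forall>k. edge c k \<in> M \<longleftrightarrow> odd k)"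
proof (rule ccontr)
  assume no: "\<not> ?thesis"
  have descend: "\<exists>k \<in> {0, 2, 4}. edge (c - hex_dir k) k \<notin> M" if "h c < g c" for c
    using no that local_minimum_face[OF h, of c] by blast
  have hs: "h (c + hex_dir k) = h c + tile_step M c k" if "k \<in> {0, 2, 4}" for c k
    using h that unfolding height_def by blast
  have gs: "g (c + hex_dir k) \<le> g c + 1" if "k \<in> {0, 2, 4}" for c k
    using height_step[OF g, of c k] that by (auto simp: tile_step_def)
  have "\<exists>f. \<forall>n. h (f n) < g (f n) \<and>
    (\<exists>k \<in> {0, 2, 4}. f (Suc n) = f n - hex_dir k \<and> edge (f (Suc n)) k \<notin> M)"
  proof (rule dependent_nat_choice)
    show "\<exists>x. h x < g x" using x by blast
    fix c n assume c: "h c < g c"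
    then obtain k where k: "k \<in> {0, 2, 4}" "edge (c - hex_dir k) k \<notin> M" using descend by blast
    have "h (c - hex_dir k) < g (c - hex_dir k)"
      using hs[OF k(1), of "c - hex_dir k"] gs[OF k(1), of "c - hex_dir k"] c k(2)
      by (simp add: tile_step_def)
    then show "\<exists>d. h d < g d \<and> (\<exists>k \<in> {0, 2, 4}. d = c - hex_dir k \<and> edge d k \<notin> M)"
      using k by blast
  qed
  then obtain f where f: "\<And>n. \<exists>k \<in> {0, 2, 4}. f (Suc n) = f n - hex_dir k \<and> edge (f (Suc n)) k \<notin> M"
    by blast
  have hf: "h (f n) = h (f 0) - int n" for n
  proof (induction n)
    case (Suc n)
    obtain k where "k \<in> {0, 2, 4}" "f (Suc n) = f n - hex_dir k" "edge (f (Suc n)) k \<notin> M" using f by blast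
    then show ?case using hs[of k "f (Suc n)"] Suc by (simp add: tile_step_def)
  qed simp
  \<comment> \<open>The torus is finite, so the descent meets some class of centres twice.\<close>
  have "\<not> inj (residue \<circ> f)"
  proof
    assume "inj (residue \<circ> f)"
    moreover have "range (residue \<circ> f) \<subseteq> residues"
      using residue_in_residues by (metis comp_apply image_subsetI)
    ultimately show False using finite_subset finite_imageD infinite_UNIV_nat
      by (metis finite_SigmaI finite_atLeastLessThan_int)
  qed
  then obtain i j where ij: "i < j" "residue (f i) = residue (f j)"
    by (metis (no_types, lifting) comp_apply injI linorder_neqE_nat)
  define l where "l = f i - f j"
  have l: "l \<in> periods"
    using periods_diff[OF residue_congruent[of "f i"] residue_congruent[of "f j"]] ij by (simp add: l_def)
  have rise: "h (y + l) = h y + int j - int i" for y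
    using height_period[OF h l, of y "f j"] hf[of i] hf[of j] by (simp add: l_def)
  obtain k where k: "k \<in> {0, 2, 4}" "f (Suc i) = f i - hex_dir k" using f by blast
  have bound: "h (z + (f (Suc i) - f m)) \<le> h z + (int m - int (Suc i))" if "Suc i \<le> m" for z m
    using that
  proof (induction m rule: dec_induct)
    case (step m)
    obtain k' where k': "k' \<in> {0, 2, 4}" "f (Suc m) = f m - hex_dir k'" using f by blast
    have "h (z + (f (Suc i) - f m) + hex_dir k') \<le> h (z + (f (Suc i) - f m)) + 1"
      using hs[OF k'(1)] by (simp add: tile_step_def)
    moreover have eq: "z + (f (Suc i) - f (Suc m)) = z + (f (Suc i) - f m) + hex_dir k'"
      by (simp add: k'(2))
    ultimately show ?case using step.IH unfolding eq by simp
  qed simp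
  \<comment> \<open>
    Reach \<open>y + l\<close> from \<open>y\<close> by the step \<open>k\<close> first and the other steps of \<open>l\<close> afterwards: the total
    rise \<open>j - i\<close> equals the number of steps, so the first step has to rise by 1 wherever \<open>y\<close> is.
  \<close>
  have free: "edge y k \<notin> M" for y
  proof -
    have eq: "y + hex_dir k + (f (Suc i) - f j) = y + l" by (simp add: k(2) l_def)
    have "h (y + l) \<le> h (y + hex_dir k) + (int j - int (Suc i))"
      using bound[of j "y + hex_dir k"] ij(1) unfolding eq by simp
    then show ?thesis using rise[of y] hs[OF k(1), of y] by (auto simp: tile_step_def split: if_splits)
  qed
  obtain b where b: "\<And>k. edge a k \<in> M \<longleftrightarrow> (even k \<longleftrightarrow> b)" using alt by (auto simp: alternating_face_iff)
  \<comment> \<open>An alternating face has matching edges on one of the two sides in every direction.\<close>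
  have "edge (a + hex_dir (k + 3)) k = edge a (k + 3)"
    using hex_edge_reverse[of p q t a "k + 3"] hex_edge_mod[of p q t "a + hex_dir (k + 3)" "k + 6"]
      hex_edge_mod[of p q t "a + hex_dir (k + 3)" k] by (simp add: add.assoc)
  then show False using free[of a] free[of "a + hex_dir (k + 3)"] b[of k] b[of "k + 3"] k(1) by auto
qed

text \<open>
  The sum of \<open>g - h\<close> over representatives of the torus drops whenever a local minimum of \<open>h\<close> is
  raised.  Raising keeps \<open>h \<le> g\<close> because positive multiples of 3 are at least 3, and keeps the
  matching nontrivial because the rotated face is alternating again.
\<close>

lemma connect_below:
  assumes "height h M" "height g N"
    and "\<And>x l. l \<in> periods \<Longrightarrow> g (x + l) - h (x + l) = g x - h x"
    and "\<And>x. h x \<le> g x" and "\<And>x. 3 dvd g x - h x"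
    and "\<not> trivial_matching p q t M"
  shows "(M, N) \<in> (resonance_adj p q t)\<^sup>*"
  using assms
proof (induction "nat (\<Sum>x\<in>residues. g x - h x)" arbitrary: h M rule: less_induct)
  case less
  note h = less.prems(1) and g = less.prems(2) and per = less.prems(3)
    and le = less.prems(4) and dvd3 = less.prems(5)
  show ?case
  proof (cases "\<exists>x. h x < g x")
    case False
    then have "h = g" using le by (metis ext order_le_less)
    then show ?thesis using height_unique[OF h] g by simp
  next
    case True
    then obtain c where c: "h c < g c" "\<And>k. edge c k \<in> M \<longleftrightarrow> odd k"
      using exists_local_minimum[OF h g] less.prems(6) unfolding trivial_matching_def by blast
    define M' where "M' = (M - face_edges p q t c) \<union> (face_edges p q t c - M)"
    define h' where "h' x = h x + (if x - c \<in> periods then 3 else 0)" for x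
    have sd: "(M - M') \<union> (M' - M) = face_edges p q t c" unfolding M'_def by blast
    have h': "height h' M'"
      using height_flip[OF h _ sd, of False] c(2) unfolding h'_def by (simp cong: if_cong)
    have "(M, M') \<in> resonance_adj p q t"
      using height_imp_perfect_matching h h' sd unfolding resonance_adj_def by blast
    moreover have "(M', N) \<in> (resonance_adj p q t)\<^sup>*"
    proof (rule less.hyps[OF _ h' g])
      show "g (x + l) - h' (x + l) = g x - h' x" if "l \<in> periods" for x l
        using per[OF that, of x] by (simp add: h'_def periods_shift_iff[OF that])
      have gt: "h x < g x" if "x - c \<in> periods" for x
        using per[OF that, of c] c(1) by simp
      show le': "h' x \<le> g x" for x
        using gt[of x] le[of x] dvd3[of x] by (auto simp: h'_def dest: zdvd_imp_le)
      show "3 dvd g x - h' x" for x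
      proof -
        have "g x - h' x = (g x - h x) - 3 * (if x - c \<in> periods then 1 else 0)" by (simp add: h'_def)
        then show ?thesis using dvd3[of x] by (metis dvd_diff dvd_triv_left)
      qed
      have "edge c k \<in> M' \<longleftrightarrow> even k" for k
        using c(2) by (auto simp: M'_def edge_in_face_iff)
      then show "\<not> trivial_matching p q t M'"
        unfolding trivial_matching_def alternating_face_iff by blast
      have fin: "finite residues" by simp
      have "(\<Sum>x\<in>residues. g x - h' x) < (\<Sum>x\<in>residues. g x - h x)"
      proof (rule sum_strict_mono_ex1[OF fin])
        have "residue c - c \<in> periods" using residue_congruent[of c] periods_sym by simp
        then show "\<exists>x\<in>residues. g x - h' x < g x - h x"
          using residue_in_residues[of c] by (intro bexI[of _ "residue c"]) (simp_all add: h'_def)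
      qed (simp add: h'_def)
      moreover have "0 \<le> (\<Sum>x\<in>residues. g x - h' x)" using le' by (intro sum_nonneg) simp
      ultimately show "nat (\<Sum>x\<in>residues. g x - h' x) < nat (\<Sum>x\<in>residues. g x - h x)" by simp
    qed
    ultimately show ?thesis by (rule converse_rtrancl_into_rtrancl)
  qed
qed

lemma invariant_under_multiples:
  fixes D :: "int \<times> int \<Rightarrow> int"
  assumes "\<And>x. D (x + (a, b)) = D x"
  shows "D (x + (n * a, n * b)) = D x"
proof (induction n rule: int_induct[of _ 0])
  case base
  then show ?case by (simp flip: zero_prod_def)
next
  case (step1 n)
  then show ?case using assms[of "x + (n * a, n * b)"] by (simp add: algebra_simps)
next
  case (step2 n)
  then show ?case using assms[of "x + ((n - 1) * a, (n - 1) * b)"] by (simp add: algebra_simps)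
qed

lemma equal_flow_imp_connected:
  assumes col: "proper_colouring p q t white"
    and Lx: "x_cut_cycle p q t Lx" and Ly: "y_cut_cycle p q t Ly"
    and M: "perfect_matching p q t M" "\<not> trivial_matching p q t M" and N: "perfect_matching p q t N"
    and fx: "flow p q t white Lx M = flow p q t white Lx N"
    and fy: "flow p q t white Ly M = flow p q t white Ly N"
  shows "(M, N) \<in> (resonance_adj p q t)\<^sup>*"
proof -
  obtain h g where h: "height h M" and g: "height g N"
    using M N perfect_matching_imp_height by blast
  define D where "D x = g x - h x" for x
  have inv: "D (x + displacement L) = D x"
    if L: "dual_cycle p q t L" "flow p q t white L M = flow p q t white L N" for x L
  proof -
    have l: "displacement L \<in> periods"
      using L by (auto simp: dual_cycle_def has_winding_vector_def periods_def)
    show ?thesis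
      using flow_eq_iff_height[OF col L(1) h g] L(2) height_period[OF h l, of x "fst L"]
        height_period[OF g l, of x "fst L"] by (simp add: D_def)
  qed
  have inv_x: "D (x + displacement Lx) = D x" for x
    using inv Lx fx by (simp add: x_cut_cycle_def)
  have "displacement Lx = (p, 0) \<or> displacement Lx = (- p, - 0)"
    using Lx by (auto simp: x_cut_cycle_def has_winding_vector_def)
  then have Dx: "D (x + (n * p, n * 0)) = D x" for x n
  proof
    assume "displacement Lx = (p, 0)"
    then have "D (x + (p, 0)) = D x" for x using inv_x by metis
    then show ?thesis by (rule invariant_under_multiples)
  next
    assume "displacement Lx = (- p, - 0)"
    then have "D (x + (- p, - 0)) = D x" for x using inv_x by metis
    then have "D (x + (- n * - p, - n * - 0)) = D x" by (rule invariant_under_multiples)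
    then show ?thesis by (simp only: minus_mult_minus)
  qed
  have inv_y: "D (x + displacement Ly) = D x" for x
    using inv Ly fy by (simp add: y_cut_cycle_def)
  have "displacement Ly = (t, q) \<or> displacement Ly = (- t, - q)"
    using Ly by (auto simp: y_cut_cycle_def has_winding_vector_def)
  then have Dy: "D (x + (n * t, n * q)) = D x" for x n
  proof
    assume "displacement Ly = (t, q)"
    then have "D (x + (t, q)) = D x" for x using inv_y by metis
    then show ?thesis by (rule invariant_under_multiples)
  next
    assume "displacement Ly = (- t, - q)"
    then have "D (x + (- t, - q)) = D x" for x using inv_y by metis
    then have "D (x + (- n * - t, - n * - q)) = D x" by (rule invariant_under_multiples)
    then show ?thesis by (simp only: minus_mult_minus)
  qed
  have per: "D (x + l) = D x" if l: "l \<in> periods" for x l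
  proof -
    obtain m n where "l = (m * p, m * 0) + (n * t, n * q)" using l by (auto simp: periods_def)
    then have "D (x + l) = D (x + (m * p, m * 0) + (n * t, n * q))" by (simp only: add.assoc)
    also have "\<dots> = D (x + (m * p, m * 0))" by (rule Dy)
    also have "\<dots> = D x" by (rule Dx)
    finally show ?thesis .
  qed
  have step3: "D (c + hex_dir k) mod 3 = D c mod 3" for c k
  proof -
    have "D (c + hex_dir k) - D c \<in> {0, 3, -3}"
      using height_step[OF h, of c k] height_step[OF g, of c k]
      by (auto simp: D_def tile_step_def)
    then have "3 dvd D (c + hex_dir k) - D c" by auto
    then show ?thesis by (simp only: mod_eq_dvd_iff)
  qed
  have D3: "D x mod 3 = D 0 mod 3" for x
  proof (rule grid_constant[where G = "\<lambda>x. D x mod 3"])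
    show "D (c + (1, 0)) mod 3 = D c mod 3" "D (c + (0, 1)) mod 3 = D c mod 3" for c
      using step3[of c 0] step3[of c 1] by (simp_all only: hex_dir_simps)
  qed
  \<comment> \<open>
    A constant to add to \<open>g\<close>: subtracting \<open>D 0\<close> makes the difference divisible by 3, and adding
    \<open>3 * S\<close> keeps that and makes the difference nonnegative, since \<open>S\<close> bounds its absolute value.
  \<close>
  define S where "S = (\<Sum>x\<in>residues. \<bar>D x - D 0\<bar>)"
  have bound: "\<bar>D x - D 0\<bar> \<le> S" for x
  proof -
    have "D x = D (residue x)" using per[OF residue_congruent[of x], of "residue x"] by simp
    then show ?thesis unfolding S_def
      using member_le_sum[of "residue x" residues "\<lambda>x. \<bar>D x - D 0\<bar>"] residue_in_residues[of x] by simp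
  qed
  show ?thesis
  proof (rule connect_below[OF h height_shift[OF g, of "3 * S - D 0"] _ _ _ M(2)])
    fix x
    show "g (x + l) + (3 * S - D 0) - h (x + l) = g x + (3 * S - D 0) - h x" if "l \<in> periods" for l
      using per[OF that, of x] by (simp add: D_def)
    show "h x \<le> g x + (3 * S - D 0)" using bound[of x] by (simp add: D_def)
    have "3 dvd D x - D 0" using D3[of x] by (simp add: mod_eq_dvd_iff)
    then have "3 dvd (D x - D 0) + 3 * S" by (intro dvd_add) simp_all
    then show "3 dvd g x + (3 * S - D 0) - h x" by (simp add: D_def algebra_simps)
  qed
qed

end

theorem theorem5p3:
  fixes p q t :: int
    and white :: "hvertex \<Rightarrow> bool"
    and Lx Ly :: dual_walk
    and M1 M2 :: "hedge set"
  assumes "p \<ge> 2" and "q \<ge> 2"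
    and "proper_colouring p q t white"
    and "x_cut_cycle p q t Lx" and "y_cut_cycle p q t Ly"
    and "perfect_matching p q t M1" and "\<not> trivial_matching p q t M1"
    and "perfect_matching p q t M2" and "\<not> trivial_matching p q t M2"
  shows "(M1, M2) \<in> (resonance_adj p q t)\<^sup>* \<longleftrightarrow>
    (\<forall>L \<in> {Lx, Ly}. flow p q t white L M1 = flow p q t white L M2)"
proof -
  interpret toroidal_polyhex p q t using assms by unfold_locales
  show ?thesis
  proof
    assume "(M1, M2) \<in> (resonance_adj p q t)\<^sup>*"
    then show "\<forall>L \<in> {Lx, Ly}. flow p q t white L M1 = flow p q t white L M2"
      using resonance_flow assms by (auto simp: x_cut_cycle_def y_cut_cycle_def)
  next
    assume "\<forall>L \<in> {Lx, Ly}. flow p q t white L M1 = flow p q t white L M2"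
    then show "(M1, M2) \<in> (resonance_adj p q t)\<^sup>*"
      using equal_flow_imp_connected assms by blast
  qed
qed

end
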